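(* For all characters $A,B,B'\in\widehat{\mathbb F_q}$ and all $x,y\in\mathbb F_q$, the following two identities hold. (1) $$\varepsilon(x-y)\,\mathbb F_1(A;B,B';BB';x,y)=\varepsilon(xy)\,\overline A(1-x)\;{}_2\mathbb F_1\left[\begin{array}{rr}B',&A\\&BB'\end{array};\frac{y-x}{1-x}\right]-\varepsilon(y-x)\,\overline B(-x)\,\overline{B'}(-y).$$ (2) $$\varepsilon(x-y)\,\mathbb F_1(A;B,B';BB';x,y)=\varepsilon(xy)\,BB'(-1)\,\overline AB'(1-x)\,\overline{B'}(1-y)\;{}_2\mathbb F_1\left[\begin{array}{rr}B',&\overline ABB'\\&BB'\end{array};\frac{x-y}{1-y}\right]-\varepsilon(x-y)\,\overline B(-x)\,\overline{B'}(-y).$$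
   Context: Let $p$ be a prime, $r\ge1$ an integer, $q=p^r$, and $\mathbb F_q$ the finite field with $q$ elements. $\widehat{\mathbb F_q}$ denotes the group of (complex-valued) multiplicative characters of $\mathbb F_q^*$; every character $\chi$, including the trivial character $\varepsilon$, is extended to $\mathbb F_q$ by $\chi(0)=0$. $\overline\chi$ is the inverse of $\chi$. Juxtaposition of characters denotes their product, and e.g. $AC(-1)$ means $(AC)(-1)$, $\overline AC$ means the product of $\overline A$ and $C$, $\overline AB'(1-x)$ is the value of the product character $\overline A B'$ at $1-x$, and $\overline ABB'$ means the product of $\overline A$, $B$ and $B'$. For $A,B,C\in\widehat{\mathbb F_q}$ and $x\in\mathbb F_q$, $${}_2\mathbb F_1\left[\begin{array}{rr}A,&B\\&C\end{array};x\right]=\varepsilon(x)\,BC(-1)\sum_{u\in\mathbb F_q}B(u)\,\overline BC(1-u)\,\overline A(1-ux).$$ For $A,B,B',C\in\widehat{\mathbb F_q}$ and $x,y\in\mathbb F_q$, $$\mathbb F_1(A;B,B';C;x,y)=\varepsilon(xy)\,AC(-1)\sum_{u\in\mathbb F_q}A(u)\,\overline AC(1-u)\,\overline B(1-ux)\,\overline{B'}(1-uy).$$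
   Formalization: Identity (1) is stated for x ≠ 1 and (2) for x ≠ 1, y ≠ 1; otherwise an argument is undefined or the claim fails: for q = 3, A = B = B' quadratic, (x,y) = (1,2), the left side is 0 but both right sides are 1. *)

theory Defs
  imports Complex_Main "HOL-Library.Function_Division"
begin

text \<open>
  A finite field is a type of class \<open>{field, finite}\<close>. A multiplicative character is a
  homomorphism from its unit group to the unit group of the complex numbers, extended by 0 at 0.
  Products and inverses of characters are the pointwise ones of
  \<open>HOL-Library.Function_Algebras\<close> and \<open>HOL-Library.Function_Division\<close>; since
  \<open>inverse 0 = 0\<close>, the pointwise inverse again vanishes at 0. The unit of the character group
  is \<open>triv_char\<close>, and not the constant function \<open>1\<close> of \<open>HOL-Library.Function_Algebras\<close>.
\<close>

definition mult_chars :: "('a :: {field, finite} \<Rightarrow> complex) set" where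
  "mult_chars = {\<chi>. \<chi> 0 = 0 \<and> (\<forall>x. x \<noteq> 0 \<longrightarrow> \<chi> x \<noteq> 0) \<and>
     (\<forall>x y. x \<noteq> 0 \<longrightarrow> y \<noteq> 0 \<longrightarrow> \<chi> (x * y) = \<chi> x * \<chi> y)}"

definition triv_char :: "'a :: {field, finite} \<Rightarrow> complex" (\<open>\<epsilon>\<close>) where
  "\<epsilon> x = (if x = 0 then 0 else 1)"

lemma triv_char_in_mult_chars: "\<epsilon> \<in> mult_chars"
  by (simp add: mult_chars_def triv_char_def)

lemma mult_in_mult_chars: "\<chi> \<in> mult_chars \<Longrightarrow> \<psi> \<in> mult_chars \<Longrightarrow> \<chi> * \<psi> \<in> mult_chars"
  by (simp add: mult_chars_def)

lemma inverse_in_mult_chars: "\<chi> \<in> mult_chars \<Longrightarrow> inverse \<chi> \<in> mult_chars"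
  by (simp add: mult_chars_def)

lemma inverse_mult_char: "\<chi> \<in> mult_chars \<Longrightarrow> inverse \<chi> * \<chi> = \<epsilon>"
  by (auto simp: mult_chars_def triv_char_def fun_eq_iff)

definition hyp2F1 ::
  "('a :: {field, finite} \<Rightarrow> complex) \<Rightarrow> ('a \<Rightarrow> complex) \<Rightarrow> ('a \<Rightarrow> complex) \<Rightarrow> 'a \<Rightarrow> complex" where
  "hyp2F1 A B C x = \<epsilon> x * (B * C) (-1) *
     (\<Sum>u\<in>UNIV. B u * (inverse B * C) (1 - u) * inverse A (1 - u * x))"

definition appellF1 ::
  "('a :: {field, finite} \<Rightarrow> complex) \<Rightarrow> ('a \<Rightarrow> complex) \<Rightarrow> ('a \<Rightarrow> complex) \<Rightarrow> ('a \<Rightarrow> complex)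
     \<Rightarrow> 'a \<Rightarrow> 'a \<Rightarrow> complex" where
  "appellF1 A B B' C x y = \<epsilon> (x * y) * (A * C) (-1) *
     (\<Sum>u\<in>UNIV. A u * (inverse A * C) (1 - u) * inverse B (1 - u * x) * inverse B' (1 - u * y))"

end

theory Submission
  imports Defs
begin

text \<open>
  Write \<open>S(x, y)\<close> for the character sum of the Appell function, without its normalising
  factors. When the last parameter is \<open>B * B'\<close>, the involution \<open>u \<mapsto> u / (u - 1)\<close> turns the four
  factors into ones whose denominators cancel, and \<open>S(x, y)\<close> becomes \<open>A (-1)\<close> times
  \<open>\<Sum>v. A v * inverse B (1 - v * (1 - x)) * inverse B' (1 - v * (1 - y))\<close>, except that \<open>v = 1\<close> is
  excluded, since it is the image of the point at infinity. The excluded summand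
  is the correction term in both identities (lemma \<open>appell_sum_reflect\<close>).

  The sum over all \<open>v\<close> is homogeneous in \<open>(1 - x, 1 - y)\<close>: scaling \<open>v\<close> replaces this pair by
  \<open>(1, (1 - y) / (1 - x))\<close>, that is, it replaces \<open>(x, y)\<close> by \<open>(0, (y - x) / (1 - x))\<close>. At
  \<open>x = 0\<close> the correction vanishes because \<open>inverse B 0 = 0\<close>, and \<open>S(0, z)\<close> is the sum of
  \<^const>\<open>hyp2F1\<close>. Applying the involution back therefore gives the first identity
  (lemma \<open>appell_sum_reduce\<close>). The second identity follows from the first by the
  Pfaff transformation of \<^const>\<open>hyp2F1\<close>, which is the substitution \<open>u \<mapsto> 1 - u\<close>
  (lemma \<open>hyp2F1_Pfaff\<close>).
\<close>

lemma mult_char_0: "\<chi> \<in> mult_chars \<Longrightarrow> \<chi> 0 = 0"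
  by (simp add: mult_chars_def)

lemma mult_char_eq_0_iff: "\<chi> \<in> mult_chars \<Longrightarrow> \<chi> x = 0 \<longleftrightarrow> x = 0"
  by (auto simp: mult_chars_def)

lemma mult_char_mult: "\<chi> \<in> mult_chars \<Longrightarrow> \<chi> (x * y) = \<chi> x * \<chi> y"
  by (cases "x = 0 \<or> y = 0") (auto simp: mult_chars_def)

lemma mult_char_1: "\<chi> \<in> mult_chars \<Longrightarrow> \<chi> 1 = 1"
  using mult_char_mult[of \<chi> 1 1] mult_char_eq_0_iff[of \<chi> 1] by simp

lemma mult_char_divide: "\<chi> \<in> mult_chars \<Longrightarrow> \<chi> (x / y) = \<chi> x / \<chi> y"
  using mult_char_mult[of \<chi> "x / y" y] mult_char_eq_0_iff[of \<chi> y]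
  by (cases "y = 0") (auto simp: mult_char_0 field_simps)

lemma mult_char_minus: "\<chi> \<in> mult_chars \<Longrightarrow> \<chi> (- x) = \<chi> (- 1) * \<chi> x"
  using mult_char_mult[of \<chi> "- 1" x] by simp

lemma mult_char_minus_1_square: "\<chi> \<in> mult_chars \<Longrightarrow> \<chi> (- 1) * \<chi> (- 1) = 1"
  using mult_char_mult[of \<chi> "- 1" "- 1"] by (simp add: mult_char_1)

lemma inverse_mult_char_minus_1: "\<chi> \<in> mult_chars \<Longrightarrow> inverse (\<chi> (- 1)) = \<chi> (- 1)"
  by (rule inverse_unique) (rule mult_char_minus_1_square)

text \<open>
  The exchange \<open>B \<leftrightarrow> inverse B * C\<close> in the sum of \<^const>\<open>hyp2F1\<close> is an involution. The
  values of \<open>C\<close> cancel only off \<open>0\<close>; at \<open>0\<close> both sides vanish.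
\<close>

lemma inverse_mult_char_complement:
  assumes "B \<in> mult_chars" "C \<in> mult_chars"
  shows "inverse (inverse B * C) * C = B"
proof
  show "(inverse (inverse B * C) * C) w = B w" for w
    using assms by (cases "w = 0") (simp_all add: mult_char_0 mult_char_eq_0_iff)
qed

text \<open>
  The substitution \<open>u = v / (v - 1)\<close> has \<open>1 - u = 1 / (1 - v)\<close> and
  \<open>1 - u * x = (1 - v * (1 - x)) / (1 - v)\<close>. The powers of \<open>1 - v\<close> cancel because the exponents
  \<open>A\<close>, \<open>inverse A * (B * B')\<close>, \<open>inverse B\<close>, \<open>inverse B'\<close> have trivial product.
\<close>

lemma appell_sum_reflect:
  fixes A B B' :: "'a :: {field, finite} \<Rightarrow> complex" and x y :: 'a
  assumes A: "A \<in> mult_chars" and B: "B \<in> mult_chars" and B': "B' \<in> mult_chars"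
  shows "(\<Sum>u\<in>UNIV. A u * (inverse A * (B * B')) (1 - u)
            * inverse B (1 - u * x) * inverse B' (1 - u * y)) =
         A (- 1) * ((\<Sum>v\<in>UNIV. A v * inverse B (1 - v * (1 - x)) * inverse B' (1 - v * (1 - y)))
            - inverse B x * inverse B' y)"
    (is "(\<Sum>u\<in>UNIV. ?f u) = A (- 1) * ((\<Sum>v\<in>UNIV. ?g v) - ?c)")
proof -
  have fg: "?f (v / (v - 1)) = A (- 1) * ?g v" if v: "v \<noteq> 1" for v
  proof -
    have eqs: "1 - v / (v - 1) = 1 / (1 - v)"
      "1 - v / (v - 1) * w = (1 - v * (1 - w)) / (1 - v)" "v / (v - 1) = - v / (1 - v)" for w
      using v by (auto simp: field_simps)
    have "A (1 - v) \<noteq> 0" "B (1 - v) \<noteq> 0" "B' (1 - v) \<noteq> 0"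
      using v by (simp_all add: A B B' mult_char_eq_0_iff)
    moreover have "A (v / (v - 1)) = A (- 1) * A v / A (1 - v)"
      unfolding eqs(3) by (simp only: mult_char_divide[OF A] mult_char_minus[OF A, of v])
    ultimately show ?thesis
      unfolding eqs(1,2)
      by (simp add: mult_char_divide A B B' mult_char_1 divide_simps)
  qed
  have "(\<Sum>u\<in>UNIV. ?f u) = (\<Sum>u\<in>UNIV - {1}. ?f u)"
    by (rule sum.mono_neutral_right) (auto simp: mult_char_0 B)
  also have "\<dots> = (\<Sum>v\<in>UNIV - {1}. A (- 1) * ?g v)"
  proof (rule sum.reindex_bij_witness[of _ "\<lambda>v. v / (v - 1)" "\<lambda>v. v / (v - 1)"])
    show "A (- 1) * ?g (a / (a - 1)) = ?f a" if a: "a \<in> UNIV - {1}" for a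
    proof -
      have "a / (a - 1) \<noteq> 1" "a / (a - 1) / (a / (a - 1) - 1) = a"
        using a by (simp_all add: field_simps)
      then show ?thesis
        using fg[of "a / (a - 1)"] by simp
    qed
  qed (simp_all add: field_simps)
  also have "\<dots> = A (- 1) * ((\<Sum>v\<in>UNIV. ?g v) - ?c)"
    by (simp add: sum_distrib_left[symmetric] sum_diff1 mult_char_1 A)
  finally show ?thesis .
qed

text \<open>
  Scaling \<open>v\<close> by \<open>1 - x\<close> in the reflected sum at \<open>(x, y)\<close> gives the reflected sum at
  \<open>(0, (y - x) / (1 - x))\<close>, because \<open>1 - (y - x) / (1 - x) = (1 - y) / (1 - x)\<close>; the factor
  \<open>inverse A (1 - x)\<close> is the cost of the scaling.
\<close>

lemma appell_sum_reduce:
  fixes A B B' :: "'a :: {field, finite} \<Rightarrow> complex" and x y :: 'a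
  assumes A: "A \<in> mult_chars" and B: "B \<in> mult_chars" and B': "B' \<in> mult_chars" and x: "x \<noteq> 1"
  shows "(\<Sum>u\<in>UNIV. A u * (inverse A * (B * B')) (1 - u)
            * inverse B (1 - u * x) * inverse B' (1 - u * y)) =
         inverse A (1 - x) * (\<Sum>u\<in>UNIV. A u * (inverse A * (B * B')) (1 - u)
            * inverse B' (1 - u * ((y - x) / (1 - x))))
         - A (- 1) * inverse B x * inverse B' y"
proof -
  let ?z = "(y - x) / (1 - x)"
  have "(\<Sum>v\<in>UNIV. A v * inverse B (1 - v * (1 - x)) * inverse B' (1 - v * (1 - y))) =
        (\<Sum>w\<in>UNIV. A (w / (1 - x)) * inverse B (1 - w) * inverse B' (1 - w * (1 - ?z)))"
  proof (rule sum.reindex_bij_witness[of _ "\<lambda>w. w / (1 - x)" "\<lambda>v. v * (1 - x)"])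
    have "1 - ?z = (1 - y) / (1 - x)"
      using x by (simp add: field_simps)
    then have "v * (1 - x) / (1 - x) = v" "v * (1 - x) * (1 - ?z) = v * (1 - y)" for v
      using x by simp_all
    then show "A (v * (1 - x) / (1 - x)) * inverse B (1 - v * (1 - x)) *
        inverse B' (1 - v * (1 - x) * (1 - ?z)) =
        A v * inverse B (1 - v * (1 - x)) * inverse B' (1 - v * (1 - y))" for v
      by presburger
  qed (use x in auto)
  also have "\<dots> = inverse A (1 - x) *
      (\<Sum>w\<in>UNIV. A w * inverse B (1 - w) * inverse B' (1 - w * (1 - ?z)))"
    by (simp add: mult_char_divide A sum_distrib_left field_simps)
  finally have scale:
    "(\<Sum>v\<in>UNIV. A v * inverse B (1 - v * (1 - x)) * inverse B' (1 - v * (1 - y))) =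
      inverse A (1 - x) *
        (\<Sum>w\<in>UNIV. A w * inverse B (1 - w) * inverse B' (1 - w * (1 - ?z)))" .
  have "(\<Sum>u\<in>UNIV. A u * (inverse A * (B * B')) (1 - u) * inverse B' (1 - u * ?z)) =
      A (- 1) * (\<Sum>w\<in>UNIV. A w * inverse B (1 - w) * inverse B' (1 - w * (1 - ?z)))"
    using appell_sum_reflect[OF A B B', of 0 ?z] by (simp add: mult_char_0 mult_char_1 B)
  then show ?thesis
    unfolding appell_sum_reflect[OF A B B', of x y] scale by (simp add: algebra_simps)
qed

text \<open>
  Under \<open>u \<mapsto> 1 - u\<close> the factor \<open>1 - u * z\<close> becomes
  \<open>1 - z + u * z = (1 - z) * (1 - u * (z / (z - 1)))\<close>. The factor \<open>C (-1)\<close> accounts for the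
  different normalisations \<open>B * C\<close> and \<open>inverse B * C * C\<close>, both taken at \<open>-1\<close>.
\<close>

lemma hyp2F1_Pfaff:
  fixes A B C :: "'a :: {field, finite} \<Rightarrow> complex" and z :: 'a
  assumes A: "A \<in> mult_chars" and B: "B \<in> mult_chars" and C: "C \<in> mult_chars" and z: "z \<noteq> 1"
  shows "hyp2F1 A B C z =
    C (- 1) * inverse A (1 - z) * hyp2F1 A (inverse B * C) C (z / (z - 1))"
proof -
  let ?t = "z / (z - 1)"
  have factor: "1 - (1 - u) * z = (1 - z) * (1 - u * ?t)" for u
    using z by (simp add: field_simps)
  have "(\<Sum>u\<in>UNIV. B u * (inverse B * C) (1 - u) * inverse A (1 - u * z)) =
        (\<Sum>u\<in>UNIV. B (1 - u) * (inverse B * C) u * inverse A (1 - (1 - u) * z))"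
    by (rule sum.reindex_bij_witness[of _ "\<lambda>u. 1 - u" "\<lambda>u. 1 - u"]) auto
  also have "\<dots> = inverse A (1 - z) *
      (\<Sum>u\<in>UNIV. (inverse B * C) u * B (1 - u) * inverse A (1 - u * ?t))"
    unfolding factor by (simp add: mult_char_mult A sum_distrib_left mult_ac)
  finally have "(\<Sum>u\<in>UNIV. B u * (inverse B * C) (1 - u) * inverse A (1 - u * z)) =
      inverse A (1 - z) *
      (\<Sum>u\<in>UNIV. (inverse B * C) u * (inverse (inverse B * C) * C) (1 - u)
         * inverse A (1 - u * ?t))"
    unfolding inverse_mult_char_complement[OF B C] .
  moreover have "\<epsilon> ?t = \<epsilon> z"
    using z by (simp add: triv_char_def)
  moreover have "(B * C) (- 1) = C (- 1) * (inverse B * C * C) (- 1)"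
    using mult_char_minus_1_square[OF C] inverse_mult_char_minus_1[OF B] by simp
  ultimately show ?thesis
    unfolding hyp2F1_def by (simp only: mult_ac)
qed

text \<open>
  For generic \<open>x\<close> and \<open>y\<close> this is lemma \<open>appell_sum_reduce\<close> times \<open>(A * (B * B')) (-1)\<close>, whose
  factor \<open>A (-1)\<close> cancels against the one in the correction term and whose remaining factor
  supplies the signs in \<open>inverse B (- x) * inverse B' (- y)\<close>. Otherwise both sides
  are \<open>0\<close>: if \<open>x * y = 0\<close> then the factor \<open>\<epsilon> (x * y)\<close> kills the two
  hypergeometric terms and \<open>inverse B (- x) * inverse B' (- y)\<close> vanishes as well; if
  \<open>x = y\<close>, the factor \<open>\<epsilon> 0\<close> inside \<^const>\<open>hyp2F1\<close> kills the term that has no factor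
  \<open>\<epsilon> (x - y)\<close> in front.
\<close>

lemma appellF1_eq_hyp2F1:
  fixes A B B' :: "'a :: {field, finite} \<Rightarrow> complex" and x y :: 'a
  assumes A: "A \<in> mult_chars" and B: "B \<in> mult_chars" and B': "B' \<in> mult_chars" and x: "x \<noteq> 1"
  shows "\<epsilon> (x - y) * appellF1 A B B' (B * B') x y =
           \<epsilon> (x * y) * inverse A (1 - x) * hyp2F1 B' A (B * B') ((y - x) / (1 - x))
           - \<epsilon> (y - x) * inverse B (- x) * inverse B' (- y)"
proof (cases "x = y \<or> x = 0 \<or> y = 0")
  case True
  then show ?thesis
    by (auto simp: appellF1_def hyp2F1_def triv_char_def mult_char_0 B B')
next
  case False
  then have eps: "\<epsilon> (x - y) = 1" "\<epsilon> (y - x) = 1" "\<epsilon> (x * y) = 1" "\<epsilon> ((y - x) / (1 - x)) = 1"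
    using x by (auto simp: triv_char_def)
  let ?S = "\<Sum>u\<in>UNIV. A u * (inverse A * (B * B')) (1 - u)
              * inverse B' (1 - u * ((y - x) / (1 - x)))"
  have norm: "(A * (B * B')) (- 1) * (A (- 1) * inverse B x * inverse B' y) =
      inverse B (- x) * inverse B' (- y)"
    using mult_char_minus_1_square[OF A]
    by (simp add: mult_char_minus[OF B, of x] mult_char_minus[OF B', of y]
        inverse_mult_char_minus_1 B B')
  have "appellF1 A B B' (B * B') x y = (A * (B * B')) (- 1) *
      (inverse A (1 - x) * ?S - A (- 1) * inverse B x * inverse B' y)"
    unfolding appellF1_def appell_sum_reduce[OF A B B' x] by (simp add: eps)
  also have "\<dots> = inverse A (1 - x) * ((A * (B * B')) (- 1) * ?S)
      - inverse B (- x) * inverse B' (- y)"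
    unfolding norm[symmetric] by (simp only: right_diff_distrib mult_ac)
  also have "(A * (B * B')) (- 1) * ?S = hyp2F1 B' A (B * B') ((y - x) / (1 - x))"
    by (simp add: hyp2F1_def eps)
  finally show ?thesis
    by (simp only: eps mult_1_left)
qed

theorem corollary3p2:
  fixes A B B' :: "'a :: {field, finite} \<Rightarrow> complex" and x y :: 'a
  assumes "A \<in> mult_chars" "B \<in> mult_chars" "B' \<in> mult_chars"
  shows "(x \<noteq> 1 \<longrightarrow>
           \<epsilon> (x - y) * appellF1 A B B' (B * B') x y =
             \<epsilon> (x * y) * inverse A (1 - x) * hyp2F1 B' A (B * B') ((y - x) / (1 - x))
             - \<epsilon> (y - x) * inverse B (- x) * inverse B' (- y)) \<and>
         (x \<noteq> 1 \<and> y \<noteq> 1 \<longrightarrow>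
           \<epsilon> (x - y) * appellF1 A B B' (B * B') x y =
             \<epsilon> (x * y) * (B * B') (-1) * (inverse A * B') (1 - x) * inverse B' (1 - y)
               * hyp2F1 B' (inverse A * B * B') (B * B') ((x - y) / (1 - y))
             - \<epsilon> (x - y) * inverse B (- x) * inverse B' (- y))"
proof (intro conjI impI)
  assume "x \<noteq> 1"
  then show "\<epsilon> (x - y) * appellF1 A B B' (B * B') x y =
      \<epsilon> (x * y) * inverse A (1 - x) * hyp2F1 B' A (B * B') ((y - x) / (1 - x))
      - \<epsilon> (y - x) * inverse B (- x) * inverse B' (- y)"
    by (rule appellF1_eq_hyp2F1[OF assms])
next
  assume xy: "x \<noteq> 1 \<and> y \<noteq> 1"
  let ?z = "(y - x) / (1 - x)"
  have z: "?z \<noteq> 1" "1 - ?z = (1 - y) / (1 - x)" "?z / (?z - 1) = (x - y) / (1 - y)"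
    using xy by (auto simp: divide_simps) (simp_all add: algebra_simps)
  have "hyp2F1 B' A (B * B') ?z =
      (B * B') (- 1) * inverse B' (1 - ?z) *
        hyp2F1 B' (inverse A * (B * B')) (B * B') (?z / (?z - 1))"
    by (rule hyp2F1_Pfaff) (use assms z in \<open>auto intro: mult_in_mult_chars\<close>)
  also have "inverse B' (1 - ?z) = B' (1 - x) * inverse B' (1 - y)"
    unfolding z by (simp add: mult_char_divide assms field_simps)
  finally have "hyp2F1 B' A (B * B') ?z = (B * B') (- 1) * (B' (1 - x) * inverse B' (1 - y)) *
      hyp2F1 B' (inverse A * B * B') (B * B') ((x - y) / (1 - y))"
    unfolding z by (simp only: mult.assoc)
  moreover have "\<epsilon> (y - x) = \<epsilon> (x - y)"
    by (simp add: triv_char_def)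
  ultimately show "\<epsilon> (x - y) * appellF1 A B B' (B * B') x y =
      \<epsilon> (x * y) * (B * B') (-1) * (inverse A * B') (1 - x) * inverse B' (1 - y)
        * hyp2F1 B' (inverse A * B * B') (B * B') ((x - y) / (1 - y))
      - \<epsilon> (x - y) * inverse B (- x) * inverse B' (- y)"
    using appellF1_eq_hyp2F1[OF assms, of x y] xy by simp
qed

end
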